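(* For every $n,r\in\mathbb{N}$, $$\sum_{k\in\mathrm{Reg}_n}k^r=\frac{n^r}{2}+\frac{n^r}{r+1}\sum_{m=0}^{\lfloor r/2\rfloor}\binom{r+1}{2m}B_{2m}\,\varrho_{1-2m}(n),$$ where $$\varrho_{1-2m}(n)=n^{1-2m}\prod_{p^{\nu}\,\|\,n}\left(p^{(2m-1)\nu}-p^{2m-1}+1\right).$$
   Context: $\mathbb{N}=\{1,2,\ldots\}$. An integer $k$ is called regular (mod $n$) if there exists $x\in\mathbb{Z}$ with $k^2x\equiv k\pmod n$, and $\mathrm{Reg}_n=\{k\in\mathbb{N}:1\le k\le n,\ k\text{ is regular (mod }n)\}$. $d\,\|\,n$ means that $d$ is a unitary divisor of $n$, i.e. $d\ge1$, $d\mid n$ and $\gcd(d,n/d)=1$; the product over $p^{\nu}\,\|\,n$ runs over the prime powers $p^\nu$ ($\nu\ge1$) in the prime factorization of $n$ (empty product $=1$). For a real number $s$, $\phi_s(n)=\sum_{d\mid n}d^s\mu(n/d)$ ($\mu$ is the Möbius function) and $\varrho_s(n)=\sum_{d\,\|\,n}\phi_s(d)$. $B_m$ are the Bernoulli numbers defined by $\frac{t}{e^t-1}=\sum_{m=0}^\infty B_m\frac{t^m}{m!}$. *)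

theory Defs
  imports
    Complex_Main
    "HOL-Number_Theory.Number_Theory"
    "HOL-Computational_Algebra.Computational_Algebra"
begin

definition regular_mod :: "nat \<Rightarrow> int \<Rightarrow> bool" where
  "regular_mod n k \<longleftrightarrow> (\<exists>x::int. [k\<^sup>2 * x = k] (mod int n))"

definition Reg :: "nat \<Rightarrow> nat set" where
  "Reg n = {k. 1 \<le> k \<and> k \<le> n \<and> regular_mod n (int k)}"

definition unitary_divisor :: "nat \<Rightarrow> nat \<Rightarrow> bool" where
  "unitary_divisor d n \<longleftrightarrow> d \<ge> 1 \<and> d dvd n \<and> coprime d (n div d)"

definition moebius_mu :: "nat \<Rightarrow> int" where
  "moebius_mu n = (if squarefree n then (- 1) ^ card (prime_factors n) else 0)"

text \<open>
  The index \<open>s\<close> may be any real number, possibly negative, hence the use of \<open>powr\<close>; for \<open>n \<ge> 1\<close> all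
  bases occurring below are positive. For \<open>n = 0\<close> the values are irrelevant.
\<close>

definition phi :: "real \<Rightarrow> nat \<Rightarrow> real" where
  "phi s n = (\<Sum>d | d dvd n. real d powr s * of_int (moebius_mu (n div d)))"

definition varrho :: "real \<Rightarrow> nat \<Rightarrow> real" where
  "varrho s n = (\<Sum>d | unitary_divisor d n. phi s d)"

text \<open>
  Bernoulli numbers, read off from the exponential generating function \<open>t / (e\<^sup>t - 1)\<close>, so that
  \<open>B\<^sub>1 = - 1/2\<close>. The divisor has constant term \<open>0\<close>, but division of formal power series over a field
  cancels the common factor \<open>t\<close>; \<open>bernoulli_egf\<close> confirms that the quotient is the intended one.
\<close>

definition bernoulli :: "nat \<Rightarrow> real" where
  "bernoulli m = fact m * fps_nth (fps_X / (fps_exp 1 - 1)) m"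

lemma bernoulli_egf:
  "Abs_fps (\<lambda>m. bernoulli m / fact m) * (fps_exp 1 - 1) = fps_X"
proof -
  have nz: "fps_exp (1::real) - 1 \<noteq> 0"
  proof
    assume "fps_exp (1::real) - 1 = 0"
    then have "fps_nth (fps_exp (1::real) - 1) 1 = 0" by simp
    then show False by simp
  qed
  have "subdegree (fps_exp (1::real) - 1) = 1"
    by (rule subdegreeI) auto
  then have "(fps_exp (1::real) - 1) dvd fps_X"
    using nz by (subst fps_dvd_iff) auto
  moreover have "Abs_fps (\<lambda>m. bernoulli m / fact m) = fps_X / (fps_exp 1 - 1)"
    by (simp add: bernoulli_def fps_eq_iff)
  ultimately show ?thesis by simp
qed

end

theory Submission
  imports Defs
begin

text \<open>
  Writing \<open>g = gcd k n\<close>, the congruence \<open>k\<^sup>2 x \<equiv> k (mod n)\<close> is solvable iff \<open>k\<close> is invertible modulo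
  \<open>n / g\<close>, that is, iff \<open>g\<close> is a unitary divisor of \<open>n\<close>. Hence \<open>Reg n\<close> is the disjoint union, over the
  unitary divisors \<open>e\<close> of \<open>n\<close>, of the sets \<open>{(n / e) j | j \<le> e, gcd j e = 1}\<close>. The power sum over the
  totatives of \<open>e\<close> follows from Moebius inversion and Faulhaber's formula. The product formula for
  \<open>varrho\<close> holds since \<open>phi\<close> and \<open>varrho\<close> are multiplicative.
\<close>

section \<open>Multiplicative functions\<close>

text \<open>For coprime \<open>a\<close> and \<open>b\<close>, the map \<open>d\<close> to
  \<open>(gcd d a, gcd d b)\<close> inverts \<open>(x, y)\<close> to \<open>x * y\<close>, so
  divisors of the product correspond to pairs of divisors.\<close>

lemma sum_divisors_mult_coprime:
  fixes f :: "nat \<Rightarrow> 'a::comm_monoid_add"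
  assumes ab: "coprime a b"
  shows "(\<Sum>d | d dvd a * b. f d) = (\<Sum>x | x dvd a. \<Sum>y | y dvd b. f (x * y))"
proof -
  have gcds: "gcd (x * y) a = x" "gcd (x * y) b = y" if "x dvd a" "y dvd b" for x y
  proof -
    have "coprime x b" "coprime y a"
      using ab that by (meson coprime_divisors coprime_commute dvd_refl)+
    then have "gcd (x * y) a = gcd x a" "gcd (x * y) b = gcd y b"
      by (auto simp: gcd_mult_left_right_cancel gcd_mult_left_left_cancel coprime_commute)
    with that show "gcd (x * y) a = x" "gcd (x * y) b = y"
      by (simp_all add: gcd_nat.absorb1)
  qed
  have "(\<Sum>x | x dvd a. \<Sum>y | y dvd b. f (x * y)) =
      (\<Sum>(x, y) \<in> {x. x dvd a} \<times> {y. y dvd b}. f (x * y))"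
    by (rule sum.cartesian_product)
  also have "\<dots> = (\<Sum>d | d dvd a * b. f d)"
  proof (rule sum.reindex_bij_witness[where j = "\<lambda>(x, y). x * y" and i = "\<lambda>d. (gcd d a, gcd d b)"], goal_cases)
    case (3 d)
    then have "d dvd a * b" by simp
    then obtain x y where "d = x * y" "x dvd a" "y dvd b" by (blast dest: division_decomp)
    then show ?case by (simp add: gcds)
  qed (auto intro: mult_dvd_mono simp: gcds)
  finally show ?thesis by simp
qed

lemma multiplicative_eq_prod_prime_powers:
  fixes f :: "nat \<Rightarrow> 'a::comm_monoid_mult"
  assumes "f 1 = 1"
    and mult: "\<And>a b. a > 0 \<Longrightarrow> b > 0 \<Longrightarrow> coprime a b \<Longrightarrow> f (a * b) = f a * f b"
    and "n > 0"
  shows "f n = (\<Prod>p\<in>prime_factors n. f (p ^ multiplicity p n))"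
proof -
  \<comment> \<open>Arbitrary finite sets of primes and arbitrary exponents make the induction go
    through; the factorization of \<open>n\<close> is one instance.\<close>
  have "f (\<Prod>p\<in>S. p ^ e p) = (\<Prod>p\<in>S. f (p ^ e p))" if "finite S" "\<And>p. p \<in> S \<Longrightarrow> prime p"
    for S and e :: "nat \<Rightarrow> nat"
    using that
  proof (induction S rule: finite_induct)
    case empty
    then show ?case using assms by simp
  next
    case (insert q S)
    have "coprime (q ^ e q) (\<Prod>p\<in>S. p ^ e p)"
      using insert.hyps insert.prems
      by (intro prod_coprime_right coprime_power_left_iff[THEN iffD2] coprime_power_right_iff[THEN iffD2] disjI1)
        (metis insertCI primes_coprime)
    moreover have "q ^ e q > 0" "(\<Prod>p\<in>S. p ^ e p) > 0"
      using insert.prems by (auto intro!: prod_pos simp: prime_gt_0_nat)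
    ultimately show ?case using insert by (simp add: mult)
  qed
  from this[of "prime_factors n" "\<lambda>p. multiplicity p n"] show ?thesis
    using \<open>n > 0\<close> in_prime_factors_imp_prime by (simp flip: prime_factorization_nat) blast
qed

section \<open>The Moebius function on coprime products and prime powers\<close>

lemma moebius_mu_mult_coprime:
  assumes "a > 0" "b > 0" "coprime a b"
  shows "moebius_mu (a * b) = moebius_mu a * moebius_mu b"
proof -
  have "squarefree (a * b) \<longleftrightarrow> squarefree a \<and> squarefree b"
    using assms squarefree_mult_coprime squarefree_multD by blast
  moreover have "prime_factors a \<inter> prime_factors b = {}"
    using assms(3) by (auto simp: in_prime_factors_iff) (meson coprime_common_divisor not_prime_unit)
  then have "card (prime_factors (a * b)) = card (prime_factors a) + card (prime_factors b)"
    using assms by (simp add: prime_factors_product card_Un_disjoint)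
  ultimately show ?thesis by (auto simp: moebius_mu_def power_add)
qed

lemma moebius_mu_prime_power:
  assumes "prime p"
  shows "moebius_mu (p ^ k) = (if k = 0 then 1 else if k = 1 then -1 else 0)"
proof -
  have "squarefree p" "\<not> is_unit p" using assms by (auto simp: squarefree_prime)
  then show ?thesis
    using assms by (auto simp: moebius_mu_def squarefree_power_iff prime_prime_factors)
qed

lemma moebius_mu_1 [simp]: "moebius_mu (Suc 0) = 1"
  by (simp add: moebius_mu_def)

section \<open>Unitary divisors and the multiplicativity of \<open>phi\<close> and
  \<open>varrho\<close>\<close>

lemma finite_unitary_divisors:
  assumes "n > 0"
  shows "finite {d. unitary_divisor d n}"
  by (rule finite_subset[of _ "{..n}"]) (use assms in \<open>auto simp: unitary_divisor_def dvd_imp_le\<close>)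

text \<open>With complements \<open>a'\<close> and \<open>b'\<close>, the cross pairs
  \<open>x\<close>, \<open>b'\<close> and \<open>y\<close>, \<open>a'\<close> are coprime because
  \<open>a\<close> and \<open>b\<close> are; only the conditions on \<open>x\<close>,
  \<open>a'\<close> and \<open>y\<close>, \<open>b'\<close> remain.\<close>

lemma unitary_divisor_mult_coprime:
  assumes "a > 0" "b > 0" "coprime a b" "x dvd a" "y dvd b"
  shows "unitary_divisor (x * y) (a * b) \<longleftrightarrow> unitary_divisor x a \<and> unitary_divisor y b"
proof -
  obtain a' b' where ab: "a = x * a'" "b = y * b'" using assms by (auto elim!: dvdE)
  then have "x > 0" "y > 0" using assms by auto
  then have "(x * y) dvd (a * b)" "a div x = a'" "b div y = b'" "a * b div (x * y) = a' * b'"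
    using ab by (auto simp: mult.assoc mult.left_commute[of a' y])
  with \<open>x > 0\<close> \<open>y > 0\<close> assms ab show ?thesis
    by (auto simp: unitary_divisor_def coprime_commute)
qed

lemma phi_mult_coprime:
  assumes "a > 0" "b > 0" "coprime a b"
  shows "phi s (a * b) = phi s a * phi s b"
proof -
  have "real (x * y) powr s * of_int (moebius_mu (a * b div (x * y))) =
      (real x powr s * of_int (moebius_mu (a div x))) * (real y powr s * of_int (moebius_mu (b div y)))"
    if "x dvd a" "y dvd b" for x y
  proof -
    from that obtain a' b' where ab: "a = x * a'" "b = y * b'" by (auto elim!: dvdE)
    with assms have pos: "x > 0" "y > 0" "a' > 0" "b' > 0" "coprime a' b'" by auto
    then have "a div x = a'" "b div y = b'" "a * b div (x * y) = a' * b'"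
      using ab by (auto simp: mult.assoc mult.left_commute[of a' y])
    with pos show ?thesis
      by (simp add: moebius_mu_mult_coprime powr_mult)
  qed
  then show ?thesis
    unfolding phi_def sum_product using assms by (subst sum_divisors_mult_coprime) (auto intro!: sum.cong)
qed

text \<open>Moving the unitarity condition into the summand makes this a sum over all divisors, to
  which \<open>sum_divisors_mult_coprime\<close> applies.\<close>

lemma varrho_altdef:
  assumes "n > 0"
  shows "varrho s n = (\<Sum>d | d dvd n. if unitary_divisor d n then phi s d else 0)"
proof -
  have "{d. unitary_divisor d n} = {d \<in> {d. d dvd n}. unitary_divisor d n}"
    by (auto simp: unitary_divisor_def)
  then show ?thesis
    unfolding varrho_def using assms by (simp only: sum.inter_filter finite_divisors_nat)
qed

lemma varrho_mult_coprime:
  assumes "a > 0" "b > 0" "coprime a b"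
  shows "varrho s (a * b) = varrho s a * varrho s b"
proof -
  have "(if unitary_divisor (x * y) (a * b) then phi s (x * y) else 0) =
      (if unitary_divisor x a then phi s x else 0) * (if unitary_divisor y b then phi s y else 0)"
    if "x dvd a" "y dvd b" for x y
  proof -
    have "x > 0" "y > 0" "coprime x y"
      using that assms by (auto intro: coprime_divisors dvd_pos_nat)
    with that assms show ?thesis by (simp add: unitary_divisor_mult_coprime phi_mult_coprime)
  qed
  then show ?thesis
    using assms by (simp add: varrho_altdef sum_divisors_mult_coprime sum_product)
qed

section \<open>Prime powers and the product formula for \<open>varrho\<close>\<close>

lemma divisors_prime_power:
  fixes p :: nat
  assumes "prime p"
  shows "{d. d dvd p ^ k} = (\<lambda>i. p ^ i) ` {..k}" "inj_on (\<lambda>i. p ^ i) {..k}"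
  using assms prime_gt_1_nat[OF assms] by (auto simp: divides_primepow_nat inj_on_def)

lemma phi_1 [simp]: "phi s (Suc 0) = 1"
  by (simp add: phi_def)

lemma phi_prime_power:
  assumes "prime p" "k > 0"
  shows "phi s (p ^ k) = real p powr (s * real k) - real p powr (s * (real k - 1))"
proof -
  have p: "p > 0" using assms prime_gt_0_nat by blast
  have pw: "real (p ^ i) powr s = real p powr (s * real i)" for i
    using p by (simp add: powr_powr mult.commute flip: powr_realpow)
  obtain j where k: "k = Suc j" using assms by (cases k) auto
  have "phi s (p ^ k) = (\<Sum>i\<le>k. real (p ^ i) powr s * of_int (moebius_mu (p ^ k div p ^ i)))"
    unfolding phi_def divisors_prime_power(1)[OF assms(1)]
    by (subst sum.reindex) (use divisors_prime_power(2)[OF assms(1)] in auto)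
  also have "\<dots> = (\<Sum>i\<le>k. real p powr (s * real i) * of_int (moebius_mu (p ^ (k - i))))"
    by (intro sum.cong refl, subst power_diff) (use p pw in auto)
  \<comment> \<open>The Moebius function vanishes at \<open>p ^ (k - i)\<close> once
    \<open>k - i\<close> is at least 2.\<close>
  also have "\<dots> = (\<Sum>i\<in>{j, k}. real p powr (s * real i) * of_int (moebius_mu (p ^ (k - i))))"
    by (rule sum.mono_neutral_right) (auto simp: k moebius_mu_prime_power[OF assms(1)])
  also have "\<dots> = real p powr (s * real k) - real p powr (s * (real k - 1))"
    using moebius_mu_prime_power[OF assms(1), of 1] by (simp add: k)
  finally show ?thesis .
qed

text \<open>For 0 < i < k the prime \<open>p\<close> divides both \<open>p ^ i\<close> and its
  complement \<open>p ^ (k - i)\<close>.\<close>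

lemma unitary_divisor_prime_power:
  assumes "prime p"
  shows "{d. unitary_divisor d (p ^ k)} = {1, p ^ k}"
proof -
  have p: "p > 0" using assms prime_gt_0_nat by blast
  have "i = 0 \<or> i = k" if "i \<le> k" "coprime (p ^ i) (p ^ k div p ^ i)" for i
  proof (rule ccontr)
    assume "\<not> ?thesis"
    moreover have "p ^ k div p ^ i = p ^ (k - i)" using p that by (simp add: power_diff)
    ultimately show False using that assms by auto
  qed
  then have "d = 1 \<or> d = p ^ k" if "unitary_divisor d (p ^ k)" for d
    using that unfolding unitary_divisor_def divides_primepow_nat[OF assms] by (metis power_0)
  then show ?thesis
    using p by (auto simp: unitary_divisor_def)
qed

lemma varrho_prime_power:
  assumes "prime p" "k > 0"
  shows "varrho s (p ^ k) = 1 + real p powr (s * real k) - real p powr (s * (real k - 1))"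
proof -
  \<comment> \<open>This keeps the two unitary divisors 1 and \<open>p ^ k\<close> distinct, so the
    sum has exactly two terms.\<close>
  have "p ^ k > Suc 0" using assms by (metis One_nat_def one_less_power prime_gt_1_nat)
  then show ?thesis
    using assms by (subst varrho_def, subst unitary_divisor_prime_power)
      (auto simp: phi_prime_power simp del: nat_power_eq_Suc_0_iff)
qed

text \<open>Both \<open>varrho s\<close> and the power with exponent \<open>s\<close> are
  multiplicative, so it suffices to pull the factor p^(s*nu) out of each local value 1 + p^(s*nu) -
  p^(s*(nu-1)).\<close>

lemma varrho_eq_prod:
  assumes "n > 0"
  shows "varrho s n = real n powr s *
    (\<Prod>p\<in>prime_factors n. real p powr (- s * real (multiplicity p n)) - real p powr (- s) + 1)"
proof -
  have "real n powr s = (\<Prod>p\<in>prime_factors n. real (p ^ multiplicity p n) powr s)"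
    by (rule multiplicative_eq_prod_prime_powers) (use assms in \<open>auto simp: powr_mult\<close>)
  moreover have "varrho s n = (\<Prod>p\<in>prime_factors n. varrho s (p ^ multiplicity p n))"
  proof (rule multiplicative_eq_prod_prime_powers)
    have "{d. unitary_divisor d 1} = {1}" by (auto simp: unitary_divisor_def)
    then show "varrho s 1 = 1" by (simp add: varrho_def)
  qed (use assms varrho_mult_coprime in auto)
  moreover have "varrho s (p ^ multiplicity p n) = real (p ^ multiplicity p n) powr s *
      (real p powr (- s * real (multiplicity p n)) - real p powr (- s) + 1)"
    if "p \<in> prime_factors n" for p
  proof -
    have p: "prime p" "multiplicity p n > 0"
      using that assms by (auto simp: prime_factors_multiplicity)
    then have "real (p ^ multiplicity p n) powr s = real p powr (s * real (multiplicity p n))"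
      by (simp add: powr_powr mult.commute prime_gt_0_nat flip: powr_realpow)
    with p show ?thesis
      by (simp add: varrho_prime_power algebra_simps prime_gt_0_nat flip: powr_add)
  qed
  ultimately show ?thesis by (simp add: prod.distrib)
qed

section \<open>Sums over totatives\<close>

text \<open>Passing to complementary divisors identifies the sum with \<open>phi 0 n\<close>. Its
  local factors are 1 - 1 = 0, so the product vanishes unless it is empty, that is, unless
  \<open>n = 1\<close>.\<close>

lemma sum_moebius_mu:
  assumes "n > 0"
  shows "(\<Sum>d | d dvd n. moebius_mu d) = (if n = 1 then 1 else 0)"
proof -
  have "(\<Sum>d | d dvd n. moebius_mu d) = (\<Sum>d | d dvd n. moebius_mu (n div d))"
    by (rule sum.reindex_bij_witness[where i = "\<lambda>d. n div d" and j = "\<lambda>d. n div d"])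
      (use assms in \<open>auto elim!: dvdE\<close>)
  then have "real_of_int (\<Sum>d | d dvd n. moebius_mu d) = phi 0 n"
    using assms by (auto simp: phi_def intro!: sum.cong)
  also have "\<dots> = (\<Prod>p\<in>prime_factors n. phi 0 (p ^ multiplicity p n))"
    by (rule multiplicative_eq_prod_prime_powers) (use assms phi_mult_coprime in auto)
  also have "\<dots> = (\<Prod>p\<in>prime_factors n. 0)"
    by (intro prod.cong refl, subst phi_prime_power)
      (auto simp: prime_factors_multiplicity prime_gt_0_nat)
  also have "\<dots> = (if n = 1 then 1 else 0)"
    using assms by (auto simp: card_gt_0_iff prime_factorization_empty_iff)
  finally show ?thesis by (metis of_int_0 of_int_1 of_int_eq_iff)
qed

text \<open>Coprimality of \<open>j\<close> and \<open>e\<close> is detected by the Moebius sum over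
  the common divisors \<open>d\<close>. After swapping the sums, \<open>j\<close> runs over the
  multiples \<open>d * i\<close> up to \<open>e\<close>.\<close>

lemma sum_totatives:
  fixes g :: "nat \<Rightarrow> real"
  assumes "e > 0"
  shows "(\<Sum>j | j \<in> {1..e} \<and> coprime j e. g j) =
    (\<Sum>d | d dvd e. of_int (moebius_mu d) * (\<Sum>i = 1..e div d. g (d * i)))"
proof -
  have "(\<Sum>j | j \<in> {1..e} \<and> coprime j e. g j) = (\<Sum>j=1..e. if coprime j e then g j else 0)"
    by (rule sum.inter_filter) simp
  also have "\<dots> = (\<Sum>j=1..e. \<Sum>d | d dvd e. if d dvd j then of_int (moebius_mu d) * g j else 0)"
  proof (intro sum.cong refl)
    fix j assume "j \<in> {1..e}"
    have "(\<Sum>d | d dvd e. if d dvd j then of_int (moebius_mu d) * g j else 0) =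
        (\<Sum>d | d \<in> {d. d dvd e} \<and> d dvd j. of_int (moebius_mu d) * g j)"
      using assms by (intro sum.inter_filter[symmetric]) auto
    also have "\<dots> = of_int (\<Sum>d | d dvd gcd j e. moebius_mu d) * g j"
      unfolding of_int_sum sum_distrib_right by (rule sum.cong) auto
    also have "\<dots> = (if coprime j e then g j else 0)"
      using assms sum_moebius_mu[of "gcd j e"] by (simp only: coprime_iff_gcd_eq_1) simp
    finally show "(if coprime j e then g j else 0) =
        (\<Sum>d | d dvd e. if d dvd j then of_int (moebius_mu d) * g j else 0)" by simp
  qed
  also have "\<dots> = (\<Sum>d | d dvd e. \<Sum>j=1..e. if d dvd j then of_int (moebius_mu d) * g j else 0)"
    by (rule sum.swap)
  also have "\<dots> = (\<Sum>d | d dvd e. of_int (moebius_mu d) * (\<Sum>i = 1..e div d. g (d * i)))"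
  proof (intro sum.cong refl)
    fix d assume "d \<in> {d. d dvd e}"
    then have d: "d > 0" using assms by (auto intro: dvd_pos_nat)
    have "(\<Sum>j=1..e. if d dvd j then of_int (moebius_mu d) * g j else 0) =
        (\<Sum>j | j \<in> {1..e} \<and> d dvd j. of_int (moebius_mu d) * g j)"
      by (intro sum.inter_filter[symmetric]) auto
    also have "\<dots> = (\<Sum>i = 1..e div d. of_int (moebius_mu d) * g (d * i))"
      by (rule sum.reindex_bij_witness[where i = "\<lambda>i. d * i" and j = "\<lambda>j. j div d"])
        (use d in \<open>auto elim!: dvdE simp: less_eq_div_iff_mult_less_eq div_le_mono mult.commute\<close>)
    finally show "(\<Sum>j=1..e. if d dvd j then of_int (moebius_mu d) * g j else 0) =
        of_int (moebius_mu d) * (\<Sum>i = 1..e div d. g (d * i))"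
      by (simp add: sum_distrib_left)
  qed
  finally show ?thesis .
qed

section \<open>Faulhaber's formula\<close>

lemma bernoulli_0_1: "bernoulli 0 = 1" "bernoulli (Suc 0) = -1/2"
proof -
  have "fps_nth (Abs_fps (\<lambda>m. bernoulli m / fact m) * (fps_exp 1 - 1)) k = fps_nth fps_X k" for k
    by (simp only: bernoulli_egf)
  \<comment> \<open>The coefficients of t and t^2 in B(t) (e^t - 1) = t determine the first two
    values.\<close>
  from this[of 1] this[of 2] show "bernoulli 0 = 1" "bernoulli (Suc 0) = -1/2"
    by (simp_all add: fps_mult_nth numeral_2_eq_2)
qed

text \<open>\<open>B(t) = t / (e\<^sup>t - 1)\<close> satisfies \<open>B(-t) = B(t) + t\<close>.\<close>

lemma bernoulli_odd:
  assumes "odd k" "k > 1"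
  shows "bernoulli k = 0"
proof -
  define B where "B = Abs_fps (\<lambda>m. bernoulli m / fact m)"
  define E where "E = fps_exp (1::real)"
  define m where "m = fps_const (-1::real) * fps_X"
  define C where "C = B oo m"
  have BE: "B * (E - 1) = fps_X" unfolding B_def E_def by (rule bernoulli_egf)
  have "C * (fps_exp (-1) - 1) = (B * (E - 1)) oo m"
    by (simp add: C_def E_def m_def fps_compose_mult_distrib fps_compose_sub_distrib)
  also have "\<dots> = - fps_X"
    unfolding BE m_def by (simp add: fps_const_neg[symmetric] del: fps_const_neg)
  \<comment> \<open>Multiplication by e^t turns e^(-t) - 1 into 1 - e^t, the divisor of
    \<open>B\<close> up to sign.\<close>
  finally have "E * (C * (fps_exp (-1) - 1)) = E * (- fps_X)" by simp
  moreover have "E * fps_exp (-1) = 1" unfolding E_def by (simp flip: fps_exp_add_mult)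
  ultimately have "C * (1 - E) = - (E * fps_X)" by (simp add: algebra_simps)
  \<comment> \<open>Here \<open>E * fps_X\<close> is split as
    \<open>(E - 1) * fps_X + fps_X\<close>, and the last term is \<open>B * (E - 1)\<close>.\<close>
  then have "C * (E - 1) = (B + fps_X) * (E - 1)"
    using BE by (simp add: algebra_simps)
  moreover have "E - 1 \<noteq> 0" by (simp add: E_def)
  ultimately have "C = B + fps_X" by simp
  \<comment> \<open>At odd \<open>k\<close> the substitution of -t flips the sign, and for
    \<open>k > 1\<close> the series \<open>fps_X\<close> contributes nothing, so the coefficient
    equals its own negative.\<close>
  then have "fps_nth C k = fps_nth (B + fps_X) k" by simp
  moreover have "fps_nth C k = - fps_nth B k"
    unfolding C_def m_def fps_compose_linear using assms by simp
  ultimately show ?thesis using assms by (simp add: B_def)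
qed

text \<open>The geometric sum of e^(jt) over j < N, times t, equals B(t) (e^(Nt) - 1); the formula
  compares coefficients of t^(r+1).\<close>

lemma sum_lessThan_power_bernoulli:
  "(\<Sum>j<N. real j ^ r) =
    (\<Sum>k\<le>r. real ((r + 1) choose k) * bernoulli k * real N ^ (r + 1 - k)) / (real r + 1)"
proof -
  define B where "B = Abs_fps (\<lambda>m. bernoulli m / fact m)"
  have "(\<Sum>j<N. fps_exp (real j)) * (fps_exp 1 - 1) = fps_exp (real N) - 1"
  proof (induction N)
    case (Suc N)
    then show ?case by (simp add: algebra_simps fps_exp_add_mult)
  qed simp
  then have "(B * (fps_exp 1 - 1)) * (\<Sum>j<N. fps_exp (real j)) = B * (fps_exp (real N) - 1)"
    by (metis mult.assoc mult.commute)
  then have "fps_X * (\<Sum>j<N. fps_exp (real j)) = B * (fps_exp (real N) - 1)"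
    unfolding B_def bernoulli_egf .
  then have "fps_nth (\<Sum>j<N. fps_exp (real j)) r = fps_nth (B * (fps_exp (real N) - 1)) (Suc r)"
    by (metis fps_X_mult_nth diff_Suc_1 nat.distinct(1))
  \<comment> \<open>The convolution stops at \<open>k = r\<close> because e^(Nt) - 1 has constant
    term 0.\<close>
  then have "(\<Sum>j<N. real j ^ r / fact r) =
      (\<Sum>k\<le>r. bernoulli k / fact k * (real N ^ (Suc r - k) / fact (Suc r - k)))"
    by (simp add: fps_mult_nth fps_sum_nth B_def atLeast0AtMost, simp add: mult.commute)
  then have "(\<Sum>j<N. real j ^ r) =
      fact r * (\<Sum>k\<le>r. bernoulli k / fact k * (real N ^ (Suc r - k) / fact (Suc r - k)))"
    by (simp add: field_simps flip: sum_divide_distrib)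
  also have "\<dots> = (\<Sum>k\<le>r. real ((r + 1) choose k) * bernoulli k * real N ^ (r + 1 - k)) / (real r + 1)"
    unfolding sum_distrib_left sum_divide_distrib
  proof (intro sum.cong refl)
    fix k assume "k \<in> {..r}"
    then have "real ((r + 1) choose k) = (real r + 1) * fact r / (fact k * fact (r + 1 - k))"
      by (subst binomial_fact) (auto simp: algebra_simps)
    moreover have "real r + 1 \<noteq> 0" by linarith
    ultimately show "fact r * (bernoulli k / fact k * (real N ^ (Suc r - k) / fact (Suc r - k))) =
        real ((r + 1) choose k) * bernoulli k * real N ^ (r + 1 - k) / (real r + 1)"
      by simp
  qed
  finally show ?thesis .
qed

text \<open>The only odd index whose term may be nonzero is 1, and \<open>r \<ge> 1\<close> places
  it in the range.\<close>

lemma sum_even_odd_terms: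
  fixes f :: "nat \<Rightarrow> real"
  assumes "r \<ge> 1" "\<And>k. odd k \<Longrightarrow> k > 1 \<Longrightarrow> f k = 0"
  shows "(\<Sum>k\<le>r. f k) = f 1 + (\<Sum>m=0..r div 2. f (2 * m))"
proof -
  have "(\<Sum>k\<le>r. f k) = (\<Sum>k\<in>insert 1 ((\<lambda>m. 2 * m) ` {0..r div 2}). f k)"
  proof (rule sum.mono_neutral_right)
    show "\<forall>i\<in>{..r} - insert 1 ((\<lambda>m. 2 * m) ` {0..r div 2}). f i = 0"
    proof
      fix i assume i: "i \<in> {..r} - insert 1 ((\<lambda>m. 2 * m) ` {0..r div 2})"
      have "odd i"
      proof
        assume "even i"
        then have "i = 2 * (i div 2)" "i div 2 \<in> {0..r div 2}" using i by (auto intro: div_le_mono)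
        with i show False by blast
      qed
      with i assms(2) show "f i = 0" by (cases "i = 0") (auto intro: Suc_lessI)
    qed
  qed (use assms in auto)
  also have "\<dots> = f 1 + (\<Sum>k\<in>(\<lambda>m. 2 * m) ` {0..r div 2}. f k)"
    by (subst sum.insert) (auto simp: image_iff)
  finally show ?thesis by (simp add: sum.reindex inj_on_def)
qed

text \<open>The factor N^r is pulled out and the rest written with \<open>powr\<close>, since the
  exponent 1 - 2m may be negative and has to match the index of \<open>phi\<close> and
  \<open>varrho\<close>.\<close>

lemma faulhaber:
  assumes "N > 0" "r \<ge> 1"
  shows "(\<Sum>i=1..N. real i ^ r) = real N ^ r / 2 + real N ^ r / (real r + 1) *
    (\<Sum>m=0..r div 2. real ((r + 1) choose (2 * m)) * bernoulli (2 * m) * real N powr (1 - 2 * real m))"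
proof -
  define f where "f k = real ((r + 1) choose k) * bernoulli k * real N ^ (r + 1 - k)" for k
  have ev: "f (2 * m) = real N ^ r * (real ((r + 1) choose (2 * m)) * bernoulli (2 * m) *
      real N powr (1 - 2 * real m))" if "m \<in> {0..r div 2}" for m
  proof -
    \<comment> \<open>As 2m is at most \<open>r\<close>, the natural-number subtraction does not
      truncate.\<close>
    have "real N ^ (r + 1 - 2 * m) = real N powr (real r + (1 - 2 * real m))"
      using that assms by (subst powr_realpow[symmetric]) (auto simp: algebra_simps)
    also have "\<dots> = real N ^ r * real N powr (1 - 2 * real m)"
      using assms by (simp add: powr_add powr_realpow)
    finally show ?thesis by (simp add: f_def)
  qed
  have "{..N} = insert 0 {1..N}" by auto
  \<comment> \<open>The added term at 0 vanishes because \<open>r \<ge> 1\<close>.\<close>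
  then have "(\<Sum>i=1..N. real i ^ r) = (\<Sum>i\<le>N. real i ^ r)" using assms by simp
  also have "\<dots> = (\<Sum>i<N. real i ^ r) + real N ^ r" by (simp flip: lessThan_Suc_atMost)
  also have "(\<Sum>i<N. real i ^ r) = (\<Sum>k\<le>r. f k) / (real r + 1)"
    unfolding f_def by (rule sum_lessThan_power_bernoulli)
  also have "(\<Sum>k\<le>r. f k) = f 1 + (\<Sum>m=0..r div 2. f (2 * m))"
    by (rule sum_even_odd_terms) (use assms in \<open>auto simp: f_def bernoulli_odd\<close>)
  \<comment> \<open>After division by r + 1 this is -N^r/2; with the end term N^r it leaves the
    N^r/2 of the claim.\<close>
  also have "f 1 = - (real r + 1) * real N ^ r / 2"
    by (simp add: f_def bernoulli_0_1 algebra_simps)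
  also have "(\<Sum>m=0..r div 2. f (2 * m)) = real N ^ r * (\<Sum>m=0..r div 2.
      real ((r + 1) choose (2 * m)) * bernoulli (2 * m) * real N powr (1 - 2 * real m))"
    unfolding sum_distrib_left using ev by (intro sum.cong) auto
  finally show ?thesis by (simp add: field_simps)
qed

text \<open>Faulhaber's formula is applied up to e/d. Since d^r (e/d)^r = e^r, the divisor
  \<open>d\<close> survives only in its Moebius value and in the powers (e/d)^(1-2m), which sum to
  \<open>phi\<close>.\<close>

lemma sum_totatives_power:
  assumes "e > 0" "r \<ge> 1"
  shows "(\<Sum>j | j \<in> {1..e} \<and> coprime j e. real j ^ r) = (if e = 1 then 1 / 2 else 0) +
    real e ^ r / (real r + 1) *
    (\<Sum>m=0..r div 2. real ((r + 1) choose (2 * m)) * bernoulli (2 * m) * phi (1 - 2 * real m) e)"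
proof -
  define c where "c m = real ((r + 1) choose (2 * m)) * bernoulli (2 * m)" for m
  define \<mu> where "\<mu> d = real_of_int (moebius_mu d)" for d
  have phi: "phi s e = (\<Sum>d | d dvd e. real (e div d) powr s * \<mu> d)" for s
    unfolding phi_def \<mu>_def
    by (rule sum.reindex_bij_witness[where i = "\<lambda>d. e div d" and j = "\<lambda>d. e div d"])
      (use assms in \<open>auto elim!: dvdE\<close>)
  have "(\<Sum>j | j \<in> {1..e} \<and> coprime j e. real j ^ r) =
      (\<Sum>d | d dvd e. \<mu> d * (\<Sum>i = 1..e div d. real (d * i) ^ r))"
    unfolding \<mu>_def by (rule sum_totatives) fact
  also have "\<dots> = (\<Sum>d | d dvd e. real e ^ r / 2 * \<mu> d + real e ^ r / (real r + 1) *
      (\<Sum>m=0..r div 2. c m * (real (e div d) powr (1 - 2 * real m) * \<mu> d)))"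
  proof (intro sum.cong refl)
    fix d assume "d \<in> {d. d dvd e}"
    then obtain q where q: "e = d * q" by (auto elim!: dvdE)
    with assms have "d > 0" "q > 0" by auto
    then have "(\<Sum>i = 1..e div d. real (d * i) ^ r) = real d ^ r * (\<Sum>i = 1..q. real i ^ r)"
      by (simp add: q power_mult_distrib sum_distrib_left)
    also have "\<dots> = real d ^ r * (real q ^ r / 2 + real q ^ r / (real r + 1) *
        (\<Sum>m=0..r div 2. c m * real q powr (1 - 2 * real m)))"
      unfolding c_def using faulhaber[OF \<open>q > 0\<close> assms(2)] by simp
    finally show "\<mu> d * (\<Sum>i = 1..e div d. real (d * i) ^ r) =
        real e ^ r / 2 * \<mu> d + real e ^ r / (real r + 1) *
        (\<Sum>m=0..r div 2. c m * (real (e div d) powr (1 - 2 * real m) * \<mu> d))"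
      using \<open>d > 0\<close> by (simp add: q power_mult_distrib algebra_simps sum_distrib_left sum_divide_distrib)
  qed
  also have "\<dots> = real e ^ r / 2 * (\<Sum>d | d dvd e. \<mu> d) + real e ^ r / (real r + 1) *
      (\<Sum>m=0..r div 2. c m * phi (1 - 2 * real m) e)"
    unfolding phi sum.distrib sum_distrib_left by (subst (2) sum.swap) simp
  \<comment> \<open>The half-power term therefore survives only for \<open>e = 1\<close>, where it
    is 1/2.\<close>
  also have "(\<Sum>d | d dvd e. \<mu> d) = (if e = 1 then 1 else 0)"
    using sum_moebius_mu[OF assms(1)] unfolding \<mu>_def by (simp flip: of_int_sum)
  finally show ?thesis by (simp add: c_def)
qed

section \<open>Regular residues\<close>

text \<open>From n | k (kx - 1) first \<open>g\<close> is cancelled, then \<open>k'\<close>, which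
  is coprime to \<open>n'\<close>. What remains is invertibility of \<open>k = g * k'\<close> modulo
  \<open>n'\<close>, that is, coprimality of \<open>g\<close> and \<open>n'\<close>.\<close>

lemma regular_mod_iff_unitary_divisor:
  assumes "n > 0"
  shows "regular_mod n (int k) \<longleftrightarrow> unitary_divisor (gcd k n) n"
proof -
  define g where "g = gcd k n"
  obtain k' n' where k: "k = g * k'" and n: "n = g * n'"
    unfolding g_def by (meson dvdE gcd_dvd1 gcd_dvd2)
  have g: "g > 0" using assms by (simp add: g_def)
  then have "gcd k' n' = 1" using g_def k n by (metis gcd_mult_distrib_nat mult_cancel1 mult_1_right neq0_conv)
  then have "coprime k' n'" by (simp only: coprime_iff_gcd_eq_1)
  then have cop: "coprime (int n') (int k')" by (simp add: coprime_commute)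
  have "regular_mod n (int k) \<longleftrightarrow> (\<exists>x. int n dvd int k * (int k * x - 1))"
    by (simp add: regular_mod_def cong_iff_dvd_diff power2_eq_square right_diff_distrib mult.assoc)
  also have "\<dots> \<longleftrightarrow> (\<exists>x. int n' dvd int k' * (int k * x - 1))"
    using g by (subst (1) k, subst n) (simp add: mult.assoc)
  also have "\<dots> \<longleftrightarrow> (\<exists>x. [int k * x = 1] (mod int n'))"
    using cop by (simp add: coprime_dvd_mult_right_iff cong_iff_dvd_diff)
  also have "\<dots> \<longleftrightarrow> coprime (int k) (int n')"
    by (rule coprime_iff_invertible_int[symmetric])
  also have "\<dots> \<longleftrightarrow> coprime g n'"
    using cop by (simp add: k coprime_commute)
  also have "\<dots> \<longleftrightarrow> unitary_divisor g n"
    using g n by (auto simp: unitary_divisor_def)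
  finally show ?thesis by (simp add: g_def)
qed

text \<open>A regular \<open>k\<close> is sorted by e = n / gcd(k, n), which is unitary because its
  complement gcd(k, n) is; \<open>j\<close> is the cofactor of \<open>k\<close>.\<close>

lemma sum_Reg:
  fixes f :: "nat \<Rightarrow> 'a::comm_monoid_add"
  assumes n: "n > 0"
  shows "(\<Sum>k\<in>Reg n. f k) =
    (\<Sum>e | unitary_divisor e n. \<Sum>j | j \<in> {1..e} \<and> coprime j e. f (n div e * j))"
proof -
  have fin: "finite {e. unitary_divisor e n}" using n by (rule finite_unitary_divisors)
  let ?S = "SIGMA e:{e. unitary_divisor e n}. {j. j \<in> {1..e} \<and> coprime j e}"
  have "(\<Sum>(e, j)\<in>?S. f (n div e * j)) = (\<Sum>k\<in>Reg n. f k)"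
  proof (rule sum.reindex_bij_witness[where j = "\<lambda>(e, j). n div e * j"
        and i = "\<lambda>k. (n div gcd k n, k div gcd k n)"], goal_cases)
    case (1 z)
    then obtain e j where z: "z = (e, j)" "unitary_divisor e n" "coprime j e" by auto
    then obtain q where q: "n = e * q" "e > 0" by (auto simp: unitary_divisor_def elim!: dvdE)
    \<comment> \<open>Coprimality of \<open>j\<close> and \<open>e\<close> gives gcd(qj, qe) = q,
      from which the pair is recovered.\<close>
    with z n have "gcd (q * j) n = q" "q > 0"
      by (auto simp: gcd_mult_left mult.commute[of e] simp flip: gcd_mult_distrib_nat)
    with z q show ?case by simp
  next
    case (2 z)
    then obtain e j where z: "z = (e, j)" "unitary_divisor e n" "coprime j e" "1 \<le> j" "j \<le> e" by auto
    then obtain q where q: "n = e * q" "e > 0" by (auto simp: unitary_divisor_def elim!: dvdE)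
    with z n have "gcd (q * j) n = q" "q > 0"
      by (auto simp: gcd_mult_left mult.commute[of e] simp flip: gcd_mult_distrib_nat)
    with z q n show ?case
      by (auto simp: Reg_def regular_mod_iff_unitary_divisor unitary_divisor_def coprime_commute mult.commute)
  next
    case (3 k)
    have "k div gcd k n * (gcd k n) = k" "n div gcd k n * gcd k n = n" by auto
    with n show ?case by (metis case_prod_conv div_mult_self1_is_m mult.commute mult_eq_0_iff neq0_conv)
  next
    case (4 k)
    define g where "g = gcd k n"
    obtain k' n' where k: "k = g * k'" and n': "n = g * n'"
      unfolding g_def by (meson dvdE gcd_dvd1 gcd_dvd2)
    have g: "g > 0" using n by (simp add: g_def)
    have "gcd k' n' = 1" using g g_def k n' by (metis gcd_mult_distrib_nat mult_cancel1 mult_1_right neq0_conv)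
    then have "coprime k' n'" by (simp only: coprime_iff_gcd_eq_1)
    moreover have "unitary_divisor g n" "1 \<le> k" "k \<le> n"
      using 4 n by (auto simp: Reg_def regular_mod_iff_unitary_divisor g_def)
    ultimately have "unitary_divisor n' n" "k' \<in> {1..n'}" "coprime k' n'"
      using g n by (auto simp: unitary_divisor_def n' k coprime_commute Suc_le_eq)
    moreover have "n div g = n'" "k div g = k'" using g k n' by simp_all
    ultimately show ?case by (simp flip: g_def)
  qed auto
  then show ?thesis by (subst sum.Sigma) (use fin in auto)
qed

section \<open>The power sum over the regular residues\<close>

theorem proposition4p1:
  fixes n r :: nat
  assumes "n \<ge> 1" and "r \<ge> 1"
  shows "(\<Sum>k\<in>Reg n. real k ^ r) =
           real n ^ r / 2 + real n ^ r / (real r + 1) *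
             (\<Sum>m = 0..r div 2. real ((r + 1) choose (2 * m)) * bernoulli (2 * m)
                * varrho (1 - 2 * real m) n)
       \<and> (\<forall>m\<in>{0..r div 2}. varrho (1 - 2 * real m) n =
           real n powr (1 - 2 * real m) *
             (\<Prod>p\<in>prime_factors n.
                real p powr ((2 * real m - 1) * real (multiplicity p n))
                - real p powr (2 * real m - 1) + 1))"
proof (intro conjI ballI)
  define c where "c m = real ((r + 1) choose (2 * m)) * bernoulli (2 * m)" for m
  have n: "n > 0" using assms by simp
  have fin: "finite {e. unitary_divisor e n}" using n by (rule finite_unitary_divisors)
  have one: "unitary_divisor 1 n" by (simp add: unitary_divisor_def)
  have "(\<Sum>k\<in>Reg n. real k ^ r) =
      (\<Sum>e | unitary_divisor e n. \<Sum>j | j \<in> {1..e} \<and> coprime j e. real (n div e * j) ^ r)"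
    by (rule sum_Reg[OF n])
  \<comment> \<open>Scaling by q = n/e turns e^r into n^r for every \<open>e\<close>, so this factor
    is common to all blocks.\<close>
  also have "\<dots> = (\<Sum>e | unitary_divisor e n. (if e = 1 then real n ^ r / 2 else 0) +
      real n ^ r / (real r + 1) * (\<Sum>m=0..r div 2. c m * phi (1 - 2 * real m) e))"
  proof (intro sum.cong refl)
    fix e assume "e \<in> {e. unitary_divisor e n}"
    then obtain q where q: "n = e * q" "e > 0" by (auto simp: unitary_divisor_def elim!: dvdE)
    have "(\<Sum>j | j \<in> {1..e} \<and> coprime j e. real (n div e * j) ^ r) =
        real q ^ r * (\<Sum>j | j \<in> {1..e} \<and> coprime j e. real j ^ r)"
      using q by (simp add: power_mult_distrib sum_distrib_left)
    also have "\<dots> = real q ^ r * ((if e = 1 then 1 / 2 else 0) +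
        real e ^ r / (real r + 1) * (\<Sum>m=0..r div 2. c m * phi (1 - 2 * real m) e))"
      unfolding c_def using sum_totatives_power[OF q(2) assms(2)] by simp
    finally show "(\<Sum>j | j \<in> {1..e} \<and> coprime j e. real (n div e * j) ^ r) =
        (if e = 1 then real n ^ r / 2 else 0) +
        real n ^ r / (real r + 1) * (\<Sum>m=0..r div 2. c m * phi (1 - 2 * real m) e)"
      by (simp add: q(1) power_mult_distrib algebra_simps)
  qed
  \<comment> \<open>The unitary divisor 1 occurs exactly once and alone supplies n^r/2.\<close>
  also have "\<dots> = real n ^ r / 2 + real n ^ r / (real r + 1) *
      (\<Sum>e | unitary_divisor e n. \<Sum>m=0..r div 2. c m * phi (1 - 2 * real m) e)"
    using fin one by (simp add: sum.distrib sum_distrib_left)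
  also have "(\<Sum>e | unitary_divisor e n. \<Sum>m=0..r div 2. c m * phi (1 - 2 * real m) e) =
      (\<Sum>m=0..r div 2. c m * varrho (1 - 2 * real m) n)"
    unfolding varrho_def sum_distrib_left by (rule sum.swap)
  finally show "(\<Sum>k\<in>Reg n. real k ^ r) =
      real n ^ r / 2 + real n ^ r / (real r + 1) *
        (\<Sum>m = 0..r div 2. real ((r + 1) choose (2 * m)) * bernoulli (2 * m)
          * varrho (1 - 2 * real m) n)"
    by (simp add: c_def)
next
  fix m
  show "varrho (1 - 2 * real m) n = real n powr (1 - 2 * real m) *
      (\<Prod>p\<in>prime_factors n. real p powr ((2 * real m - 1) * real (multiplicity p n))
        - real p powr (2 * real m - 1) + 1)"
    using varrho_eq_prod[of n "1 - 2 * real m"] assms by simp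
qed

end
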